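(* Let $A$ and $B$ be distinct irreducible real conics in a generic setting, with rational parameterizations $x\mapsto[E_0(x):E_1(x):E_2(x)]$ of $A$ and $y\mapsto[G_0(y):G_1(y):G_2(y)]$ of $B$ by real polynomials of degree at most two, and let $$F(x,y)=\det\begin{pmatrix} E_0(x) & E_1(x) & E_2(x) \\ E_0'(x) & E_1'(x) & E_2'(x) \\ G_0(y) & G_1(y) & G_2(y) \end{pmatrix}$$ be the corresponding biquadratic polynomial. Then the Poncelet problem for $A,B$ is periodic if and only if the John mapping on the biquadratic curve $F(x,y)=0$ is periodic, and in this case their periods coincide.
   Context: Poncelet problem: on the set $\{(Q,P)\in A\times B: P \text{ lies on the tangent line to }A\text{ at }Q\}$ define $I_B(Q,P)=(Q,\tilde P)$, where $\tilde P$ is the second intersection point of $B$ with the tangent to $A$ at $Q$, and $I_A(Q,P)=(\tilde Q,P)$, where $\tilde Q$ is the point of contact of the second tangent to $A$ drawn through $P$ (double points/tangents being counted as fixed). The Poncelet mapping is $U=I_B\circ I_A$; the problem is periodic if $U$ has a periodic point (a closed trajectory), the period being the smallest $n\geq 1$ with $U^n(Q,P)=(Q,P)$. John mapping on the curve $C=\{F(x,y)=0\}$, where $x,y$ are real parameters with the value $\infty$ allowed: $I_1(x,y)=(x,\tilde y)$, where $\tilde y$ is the other root of the quadratic equation $F(x,\cdot)=0$, and $I_2(x,y)=(\tilde x,y)$, where $\tilde x$ is the other root of $F(\cdot,y)=0$ (double roots give fixed points); $T=I_2I_1$. It is periodic if it has a periodic point; the period is the smallest $n\ge1$ with $T^nM=M$.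 Generic setting: the conics are in one of the following dispositions: (1) $A$ lies strictly inside $B$ (without contact), so that every tangent line to $A$ cuts $B$ in two different points; (2) $A$ cuts $B$ in four points and some straight line has no common point with $A$ and $B$; (3) $A$ intersects $B$ at only two points, without contacts; (4) $A$ lies strictly outside $B$ and $B$ lies outside $A$; (5) $A$ cuts $B$ in four points and every straight line has a common point with $A$ or $B$. *)

theory Defs
  imports "HOL-Analysis.Analysis" "HOL-Computational_Algebra.Polynomial"
begin

section \<open>Conics in the real projective plane\<close>

text \<open>
  Points and lines of the real projective plane are the linear subspaces of
  dimension 1 and 2 of the space of homogeneous coordinates; incidence is inclusion.
\<close>

definition proj_point :: "(real^3) set \<Rightarrow> bool" where
  "proj_point p \<longleftrightarrow> subspace p \<and> dim p = 1"

definition proj_line :: "(real^3) set \<Rightarrow> bool" where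
  "proj_line l \<longleftrightarrow> subspace l \<and> dim l = 2"

text \<open>
  A real conic is given by the symmetric matrix of its ternary quadratic form.
  Factors of a form are themselves forms, so a quadratic form is irreducible (over the
  complex numbers) iff it is not a product of two linear forms; the zero form is
  excluded as well.
\<close>

definition irreducible_conic :: "real^3^3 \<Rightarrow> bool" where
  "irreducible_conic M \<longleftrightarrow> transpose M = M \<and>
     \<not> (\<exists>l m :: complex^3. \<forall>v :: complex^3.
          (\<Sum>i\<in>UNIV. \<Sum>j\<in>UNIV. complex_of_real (M $ i $ j) * v $ i * v $ j) =
          (\<Sum>i\<in>UNIV. l $ i * v $ i) * (\<Sum>i\<in>UNIV. m $ i * v $ i))"

definition conic_points :: "real^3^3 \<Rightarrow> (real^3) set set" where
  "conic_points M = {p. proj_point p \<and> (\<forall>v\<in>p. v \<bullet> (M *v v) = 0)}"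

text \<open>The gradient of \<open>v \<bullet> (M *v v)\<close> is \<open>2 *\<^sub>R (M *v v)\<close>, as \<open>M\<close> is symmetric.\<close>

definition tangent_line :: "real^3^3 \<Rightarrow> (real^3) set \<Rightarrow> (real^3) set" where
  "tangent_line M p = {w. \<forall>v\<in>p. (M *v v) \<bullet> w = 0}"

definition inside_conic :: "real^3^3 \<Rightarrow> (real^3) set \<Rightarrow> bool" where
  "inside_conic M p \<longleftrightarrow>
     proj_point p \<and> (\<forall>l. proj_line l \<and> p \<subseteq> l \<longrightarrow> card {r \<in> conic_points M. r \<subseteq> l} = 2)"

definition outside_conic :: "real^3^3 \<Rightarrow> (real^3) set \<Rightarrow> bool" where
  "outside_conic M p \<longleftrightarrow> proj_point p \<and> p \<notin> conic_points M \<and> \<not> inside_conic M p"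

definition generic_setting :: "real^3^3 \<Rightarrow> real^3^3 \<Rightarrow> bool" where
  "generic_setting A B \<longleftrightarrow>
     (\<forall>p \<in> conic_points A. inside_conic B p) \<or>
     (card (conic_points A \<inter> conic_points B) = 4 \<and>
        (\<exists>l. proj_line l \<and> (\<forall>p \<in> conic_points A \<union> conic_points B. \<not> p \<subseteq> l))) \<or>
     (card (conic_points A \<inter> conic_points B) = 2 \<and>
        (\<forall>p \<in> conic_points A \<inter> conic_points B. tangent_line A p \<noteq> tangent_line B p)) \<or>
     ((\<forall>p \<in> conic_points A. outside_conic B p) \<and> (\<forall>p \<in> conic_points B. outside_conic A p)) \<or>
     (card (conic_points A \<inter> conic_points B) = 4 \<and>
        (\<forall>l. proj_line l \<longrightarrow> (\<exists>p \<in> conic_points A \<union> conic_points B. p \<subseteq> l)))"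


section \<open>Periodic points\<close>

definition least_period :: "('a \<Rightarrow> 'a) \<Rightarrow> 'a \<Rightarrow> nat \<Rightarrow> bool" where
  "least_period f p n \<longleftrightarrow>
     n \<ge> 1 \<and> (f ^^ n) p = p \<and> (\<forall>k. 1 \<le> k \<and> k < n \<longrightarrow> (f ^^ k) p \<noteq> p)"

definition periodic_on :: "'a set \<Rightarrow> ('a \<Rightarrow> 'a) \<Rightarrow> bool" where
  "periodic_on S f \<longleftrightarrow> (\<exists>p\<in>S. \<exists>n\<ge>1. (f ^^ n) p = p)"

definition has_period_on :: "'a set \<Rightarrow> ('a \<Rightarrow> 'a) \<Rightarrow> nat \<Rightarrow> bool" where
  "has_period_on S f n \<longleftrightarrow> (\<exists>p\<in>S. least_period f p n)"

text \<open>
  The second element of a solution set having at most two elements; a set with the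
  single element \<open>p\<close> stands for a double solution, whose second element is again \<open>p\<close>.
\<close>

definition other :: "'a set \<Rightarrow> 'a \<Rightarrow> 'a" where
  "other S p = (if \<exists>r\<in>S. r \<noteq> p then THE r. r \<in> S \<and> r \<noteq> p else p)"


section \<open>The Poncelet mapping\<close>

definition poncelet_set :: "real^3^3 \<Rightarrow> real^3^3 \<Rightarrow> ((real^3) set \<times> (real^3) set) set" where
  "poncelet_set A B = {(Q, P). Q \<in> conic_points A \<and> P \<in> conic_points B \<and> P \<subseteq> tangent_line A Q}"

definition poncelet_IB ::
  "real^3^3 \<Rightarrow> real^3^3 \<Rightarrow> (real^3) set \<times> (real^3) set \<Rightarrow> (real^3) set \<times> (real^3) set" where
  "poncelet_IB A B = (\<lambda>(Q, P). (Q, other {R \<in> conic_points B. R \<subseteq> tangent_line A Q} P))"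

definition poncelet_IA ::
  "real^3^3 \<Rightarrow> (real^3) set \<times> (real^3) set \<Rightarrow> (real^3) set \<times> (real^3) set" where
  "poncelet_IA A = (\<lambda>(Q, P). (other {R \<in> conic_points A. P \<subseteq> tangent_line A R} Q, P))"

definition poncelet_map ::
  "real^3^3 \<Rightarrow> real^3^3 \<Rightarrow> (real^3) set \<times> (real^3) set \<Rightarrow> (real^3) set \<times> (real^3) set" where
  "poncelet_map A B = poncelet_IB A B \<circ> poncelet_IA A"


section \<open>The John mapping\<close>

datatype 'a projline = Fin 'a | Infty

text \<open>
  Evaluation of a polynomial of degree at most 2 as a binary quadratic form, at
  \<open>[x : 1]\<close> and at \<open>[1 : 0]\<close> respectively.
\<close>

fun eval2 :: "'a::comm_semiring_1 poly \<Rightarrow> 'a projline \<Rightarrow> 'a" where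
  "eval2 p (Fin x) = poly p x"
| "eval2 p Infty = coeff p 2"

text \<open>
  A polynomial in two variables is a polynomial in the second variable \<open>y\<close> whose
  coefficients are polynomials in the first variable \<open>x\<close>.
\<close>

definition bieval :: "real poly poly \<Rightarrow> real projline \<Rightarrow> real projline \<Rightarrow> real" where
  "bieval F x y = eval2 (eval2 F (map_projline (\<lambda>c. [:c:]) y)) x"

definition john_curve :: "real poly poly \<Rightarrow> (real projline \<times> real projline) set" where
  "john_curve F = {(x, y). bieval F x y = 0}"

definition john_I1 ::
  "real poly poly \<Rightarrow> real projline \<times> real projline \<Rightarrow> real projline \<times> real projline" where
  "john_I1 F = (\<lambda>(x, y). (x, other {y'. bieval F x y' = 0} y))"

definition john_I2 ::
  "real poly poly \<Rightarrow> real projline \<times> real projline \<Rightarrow> real projline \<times> real projline" where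
  "john_I2 F = (\<lambda>(x, y). (other {x'. bieval F x' y = 0} x, y))"

definition john_map ::
  "real poly poly \<Rightarrow> real projline \<times> real projline \<Rightarrow> real projline \<times> real projline" where
  "john_map F = john_I2 F \<circ> john_I1 F"


section \<open>Parameterized conics and the associated biquadratic polynomial\<close>

definition rational_parameterization :: "real poly^3 \<Rightarrow> real^3^3 \<Rightarrow> bool" where
  "rational_parameterization E M \<longleftrightarrow>
     (\<forall>i. degree (E $ i) \<le> 2) \<and>
     bij_betw (\<lambda>x. span {\<chi> i. eval2 (E $ i) x}) UNIV (conic_points M)"

text \<open>
  The polynomials \<open>E $ i\<close> are in the variable \<open>x\<close>, the polynomials \<open>G $ i\<close> in \<open>y\<close>.
  The top coefficients cancel in the minors of the first two rows, so the determinant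
  has degree at most 2 in each variable, as required by \<^const>\<open>bieval\<close>.
\<close>

definition conic_biquadratic :: "real poly^3 \<Rightarrow> real poly^3 \<Rightarrow> real poly poly" where
  "conic_biquadratic E G =
     det (vector [\<chi> i. [:E $ i:],
                  \<chi> i. [:pderiv (E $ i):],
                  \<chi> i. map_poly (\<lambda>c. [:c:]) (G $ i)] :: real poly poly^3^3)"

end

theory Submission
  imports Defs
begin

text \<open>
  Write the parameterization of \<open>A\<close> as \<open>E(x) = x\<^sup>2 a + x b + c\<close>. Comparing coefficients in the
  identity \<open>E(x) \<bullet> A E(x) = 0\<close>, and using that an irreducible conic contains no line, one finds
  that \<open>a, b, c\<close> are linearly independent and that \<open>E(x) \<times> E'(x)\<close> is a nonzero constant multiple
  of the polar \<open>A E(x)\<close>, also at \<open>x = \<infinity>\<close>. As \<open>F(x,y) = (E(x) \<times> E'(x)) \<bullet> G(y)\<close>, the equation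
  \<open>F(x,y) = 0\<close> says that \<open>G(y)\<close> lies on the tangent to \<open>A\<close> at \<open>E(x)\<close>. Hence the bijection
  \<open>(x,y) \<mapsto> (E(x), G(y))\<close> intertwines \<open>I\<^sub>1\<close> with \<open>I\<^sub>B\<close> and \<open>I\<^sub>2\<close> with \<open>I\<^sub>A\<close>. The two composites are
  taken in opposite orders, so \<open>T = I\<^sub>2 I\<^sub>1\<close> and \<open>U = I\<^sub>B I\<^sub>A\<close> become conjugate after a further
  twist by the involution \<open>I\<^sub>1\<close>.
\<close>

section \<open>Symmetric forms on real three-space\<close>

text \<open>Cramer's rule with the determinant multiplied out, so that it can also be applied to
  vectors not yet known to be independent.\<close>

lemma cramer_cross3:
  "((cross3 a b) \<bullet> c) *\<^sub>R w =
     (cross3 w b \<bullet> c) *\<^sub>R a + (cross3 a w \<bullet> c) *\<^sub>R b + (cross3 a b \<bullet> w) *\<^sub>R c"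
  by (simp add: vec_eq_iff forall_3 cross3_def inner_vec_def sum_3 vector_3 algebra_simps)

lemma inner_matrix_symmetric:
  fixes M :: "real^'n^'n"
  assumes "transpose M = M"
  shows "v \<bullet> (M *v w) = w \<bullet> (M *v v)"
  by (metis assms dot_lmul_matrix inner_commute transpose_matrix_vector)

lemma irreducible_conic_isotropic_line:
  assumes irr: "irreducible_conic M"
    and pp: "p \<bullet> (M *v p) = 0" and ee: "e \<bullet> (M *v e) = 0" and pe: "p \<bullet> (M *v e) = 0"
  shows "cross3 p e = 0"
proof (rule ccontr)
  assume n0: "cross3 p e \<noteq> 0"
  define n where "n = cross3 p e"
  define d where "d = n \<bullet> n"
  have d: "d \<noteq> 0" using n0 by (simp add: d_def n_def)
  have sym: "transpose M = M" using irr by (simp add: irreducible_conic_def)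
  have ep: "e \<bullet> (M *v p) = 0" using pe inner_matrix_symmetric[OF sym] by metis
  txt \<open>The form vanishes on the plane orthogonal to \<open>n\<close>, so the linear form \<open>n\<close> divides it;
    the vector \<open>m\<close> below is the cofactor.\<close>
  define m where "m = (2 / d) *\<^sub>R (M *v n) - ((n \<bullet> (M *v n)) / d\<^sup>2) *\<^sub>R n"
  have form: "v \<bullet> (M *v v) = (n \<bullet> v) * (m \<bullet> v)" for v
  proof -
    \<comment> \<open>With \<open>n\<close> as third vector the determinant is
      \<open>n \<bullet> n = d\<close> and the coefficient of \<open>n\<close> is
      \<open>n \<bullet> v\<close>.\<close>
    obtain s t where w: "d *\<^sub>R v = s *\<^sub>R p + t *\<^sub>R e + (n \<bullet> v) *\<^sub>R n"
      using cramer_cross3[of p e n v] unfolding d_def n_def by blast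
    define u where "u = s *\<^sub>R p + t *\<^sub>R e"
    have uu: "u \<bullet> (M *v u) = 0"
      using pp ee pe ep by (simp add: u_def matrix_vector_right_distrib
        matrix_vector_mult_scaleR inner_add_left inner_add_right)
    have dv: "d *\<^sub>R v = u + (n \<bullet> v) *\<^sub>R n" using w by (simp add: u_def)
    have u: "u = d *\<^sub>R v - (n \<bullet> v) *\<^sub>R n" by (simp add: dv)
    have "0 = d\<^sup>2 * (v \<bullet> (M *v v)) - 2 * d * (n \<bullet> v) * (v \<bullet> (M *v n)) + (n \<bullet> v)\<^sup>2 * (n \<bullet> (M *v n))"
      using uu inner_matrix_symmetric[OF sym, of n v] unfolding u
      by (simp add: matrix_vector_mult_diff_distrib matrix_vector_mult_scaleR inner_diff_left
          inner_diff_right power2_eq_square algebra_simps)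
    moreover have dm: "d\<^sup>2 * (m \<bullet> v) = 2 * d * (v \<bullet> (M *v n)) - (n \<bullet> (M *v n)) * (n \<bullet> v)"
      using d by (simp add: m_def inner_diff_left inner_commute[of v] field_simps power2_eq_square)
    moreover from dm have "(n \<bullet> v) * (d\<^sup>2 * (m \<bullet> v)) =
        (n \<bullet> v) * (2 * d * (v \<bullet> (M *v n)) - (n \<bullet> (M *v n)) * (n \<bullet> v))" by simp
    ultimately have "d\<^sup>2 * (v \<bullet> (M *v v)) = d\<^sup>2 * ((n \<bullet> v) * (m \<bullet> v))"
      by (auto simp: algebra_simps power2_eq_square)
    then show ?thesis using d by simp
  qed
  \<comment> \<open>Polarizing \<open>form\<close> on basis vectors yields the matrix entries. They
    carry the real factorization over to complex vectors, the setting in which irreducibility is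
    stated.\<close>
  have M: "M $ i $ j + M $ j $ i = n $ i * m $ j + n $ j * m $ i" for i j
  proof -
    have ax: "axis k 1 \<bullet> (M *v axis l 1) = M $ k $ l" for k l
      by (simp add: matrix_vector_mul_component inner_axis inner_axis')
    have "(axis i 1 + axis j 1) \<bullet> (M *v (axis i 1 + axis j 1))
        - axis i 1 \<bullet> (M *v axis i 1) - axis j 1 \<bullet> (M *v axis j 1)
        = n $ i * m $ j + n $ j * m $ i"
      unfolding form by (simp add: inner_add_right inner_axis algebra_simps)
    then show ?thesis
      by (simp add: matrix_vector_right_distrib inner_add_left inner_add_right ax)
  qed
  have Mij: "2 * complex_of_real (M $ i $ j) =
      of_real (n $ i) * of_real (m $ j) + of_real (n $ j) * of_real (m $ i)" for i j
  proof -
    have "M $ j $ i = transpose M $ i $ j" by (simp add: transpose_def)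
    then have "M $ j $ i = M $ i $ j" by (simp only: sym)
    then have "2 * M $ i $ j = n $ i * m $ j + n $ j * m $ i" using M[of i j] by simp
    then show ?thesis by (metis of_real_add of_real_mult of_real_numeral)
  qed
  have "(\<Sum>i\<in>UNIV. \<Sum>j\<in>UNIV. complex_of_real (M $ i $ j) * v $ i * v $ j) =
          (\<Sum>i\<in>UNIV. (\<chi> i. complex_of_real (n $ i)) $ i * v $ i)
          * (\<Sum>i\<in>UNIV. (\<chi> i. complex_of_real (m $ i)) $ i * v $ i)"
    (is "?q = ?l * ?m") for v :: "complex^3"
  proof -
    have "2 * ?q = (\<Sum>i\<in>UNIV. \<Sum>j\<in>UNIV. (2 * complex_of_real (M $ i $ j)) * v $ i * v $ j)"
      by (simp add: sum_distrib_left mult.assoc)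
    also have "\<dots> = 2 * (?l * ?m)"
      unfolding Mij sum_3 vec_lambda_beta by algebra
    finally show ?thesis by (simp only: mult_cancel_left) simp
  qed
  then show False using irr unfolding irreducible_conic_def by blast
qed

section \<open>Binary quadratic forms and their zeros\<close>

text \<open>The form \<open>X^2 a + X Y b + Y^2 c\<close> at \<open>[x : 1]\<close> and
  \<open>[1 : 0]\<close>. Coefficients may be vectors, for parameterizations, or reals, for
  equations.\<close>

fun qform :: "'a::real_vector \<Rightarrow> 'a \<Rightarrow> 'a \<Rightarrow> real projline \<Rightarrow> 'a" where
  "qform a b c (Fin x) = x\<^sup>2 *\<^sub>R a + x *\<^sub>R b + c"
| "qform a b c Infty = a"

lemma inner_qform:
  "v \<bullet> qform a b c x = qform (v \<bullet> a) (v \<bullet> b) (v \<bullet> c) x"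
  by (cases x) (simp_all add: inner_add_right)

lemma qform_three_roots:
  fixes p q r :: real
  assumes "qform p q r x = 0" "qform p q r y = 0" "qform p q r z = 0"
    and "x \<noteq> y" "y \<noteq> z" "x \<noteq> z"
  shows "p = 0 \<and> q = 0 \<and> r = 0"
proof -
  \<comment> \<open>A root at \<open>Infty\<close> forces \<open>p = 0\<close> and leaves a linear
    polynomial with two finite roots.\<close>
  have lin: "q = 0 \<and> r = 0" if "s * q + r = 0" "t * q + r = 0" "s \<noteq> t" for s t
  proof -
    have "(s - t) * q = (s * q + r) - (t * q + r)" by (simp add: algebra_simps)
    then have "(s - t) * q = 0" using that by simp
    then show ?thesis using that by simp
  qed
  have *: "p = 0 \<and> q = 0 \<and> r = 0"
    if "s\<^sup>2 * p + s * q + r = 0" "t\<^sup>2 * p + t * q + r = 0" "u\<^sup>2 * p + u * q + r = 0"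
      "s \<noteq> t" "t \<noteq> u" "s \<noteq> u" for s t u
  proof -
    \<comment> \<open>Divided differences: dividing out the distinct roots lowers the
      degree.\<close>
    have "(s - t) * ((s + t) * p + q) = (s\<^sup>2 * p + s * q + r) - (t\<^sup>2 * p + t * q + r)"
      "(s - u) * ((s + u) * p + q) = (s\<^sup>2 * p + s * q + r) - (u\<^sup>2 * p + u * q + r)"
      by (simp_all add: algebra_simps power2_eq_square)
    then have *: "(s + t) * p + q = 0" "(s + u) * p + q = 0" using that by simp_all
    have "(t - u) * p = ((s + t) * p + q) - ((s + u) * p + q)" by (simp add: algebra_simps)
    then have "p = 0" using * that by simp
    then have "q = 0" using * by simp
    then show ?thesis using that \<open>p = 0\<close> by simp
  qed
  show ?thesis
    using assms lin * by (cases x; cases y; cases z) auto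
qed

section \<open>The second solution of a quadratic equation\<close>

definition at_most_two :: "'a set \<Rightarrow> bool" where
  "at_most_two S \<longleftrightarrow> (\<forall>x\<in>S. \<forall>y\<in>S. \<forall>z\<in>S. x = y \<or> y = z \<or> x = z)"

lemma at_most_two_qform_roots:
  fixes p q r :: real
  assumes "p \<noteq> 0 \<or> q \<noteq> 0 \<or> r \<noteq> 0"
  shows "at_most_two {x. qform p q r x = 0}"
  using assms qform_three_roots[of p q r] unfolding at_most_two_def by blast

lemma other_eqI:
  assumes "at_most_two S" "p \<in> S" "r \<in> S" "r \<noteq> p"
  shows "other S p = r"
proof -
  have "(THE r. r \<in> S \<and> r \<noteq> p) = r"
    using assms unfolding at_most_two_def by (intro the_equality) blast+
  moreover have "\<exists>r\<in>S. r \<noteq> p" using assms by blast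
  ultimately show ?thesis by (simp only: other_def if_True)
qed

lemma other_cases:
  assumes "at_most_two S" "p \<in> S"
  obtains "S = {p}" "other S p = p" | r where "r \<noteq> p" "S = {p, r}" "other S p = r"
proof (cases "\<exists>r\<in>S. r \<noteq> p")
  case True
  then obtain r where r: "r \<in> S" "r \<noteq> p" by blast
  then have "S = {p, r}" using assms unfolding at_most_two_def by blast
  then show thesis using that(2)[of r] r other_eqI[OF assms] by blast
next
  case False
  then have "S = {p}" using assms(2) by blast
  then show thesis using that(1) by (simp add: other_def)
qed

lemma other_in:
  assumes "at_most_two S" "p \<in> S"
  shows "other S p \<in> S"
  using assms by (rule other_cases) auto

lemma other_doubleton: "other {p, r} p = r"
  by (auto simp: other_def)

lemma other_other:
  assumes "at_most_two S" "p \<in> S"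
  shows "other S (other S p) = p"
  using assms by (rule other_cases) (simp_all add: other_doubleton insert_commute)

text \<open>If \<open>f\<close> identifies the two elements, the image is a singleton and
  \<open>other\<close> returns its only element, so both sides still agree.\<close>

lemma other_image:
  assumes "at_most_two S" "p \<in> S"
  shows "other (f ` S) (f p) = f (other S p)"
  using assms by (rule other_cases) (simp_all add: other_doubleton
    other_doubleton[of "f p" "f p", simplified])

section \<open>Conjugate maps\<close>

text \<open>Orbits stay in \<open>S\<close>, so the conjugacy passes to all iterates; injectivity of
  \<open>h\<close> on \<open>S\<close> then matches the return times.\<close>

lemma periods_conjugate:
  assumes bij: "bij_betw h S S'" and maps: "f ` S \<subseteq> S"
    and conj: "\<And>z. z \<in> S \<Longrightarrow> g (h z) = h (f z)"
  shows "periodic_on S' g \<longleftrightarrow> periodic_on S f"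
    and "has_period_on S' g n \<longleftrightarrow> has_period_on S f n"
proof -
  have it: "(f ^^ k) z \<in> S \<and> (g ^^ k) (h z) = h ((f ^^ k) z)" if "z \<in> S" for k z
    using that maps conj by (induction k) auto
  have eq: "(g ^^ k) (h z) = h z \<longleftrightarrow> (f ^^ k) z = z" if "z \<in> S" for k z
    using it[OF that] bij that by (metis bij_betw_inv_into_left)
  have S': "S' = h ` S" using bij by (simp add: bij_betw_def)
  show "periodic_on S' g \<longleftrightarrow> periodic_on S f"
    by (auto simp: periodic_on_def S' eq)
  show "has_period_on S' g n \<longleftrightarrow> has_period_on S f n"
    by (auto simp: has_period_on_def least_period_def S' eq)
qed

section \<open>The biquadratic polynomial in vector form\<close>

definition coeff_vec :: "real poly^3 \<Rightarrow> nat \<Rightarrow> real^3" where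
  "coeff_vec E k = (\<chi> i. coeff (E $ i) k)"

definition conic_pt :: "real poly^3 \<Rightarrow> real projline \<Rightarrow> real^3" where
  "conic_pt E = qform (coeff_vec E 2) (coeff_vec E 1) (coeff_vec E 0)"

text \<open>The cross product of \<open>qform a b c\<close> with its derivative, homogenized to degree two.\<close>

definition tangent_form :: "real^3 \<Rightarrow> real^3 \<Rightarrow> real^3 \<Rightarrow> real projline \<Rightarrow> real^3" where
  "tangent_form a b c = qform (cross3 b a) (2 *\<^sub>R cross3 c a) (cross3 c b)"

lemma degree_le_2_expand:
  fixes p :: "'a::comm_semiring_1 poly"
  assumes "degree p \<le> 2"
  shows "p = [:coeff p 0, coeff p 1, coeff p 2:]"
proof (rule poly_eqI)
  fix n
  show "coeff p n = coeff [:coeff p 0, coeff p 1, coeff p 2:] n"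
    using assms coeff_eq_0[of p n]
    by (cases "n \<le> 2") (auto simp: coeff_pCons numeral_2_eq_2 le_Suc_eq split: nat.splits)
qed

lemma eval2_conic_pt:
  assumes "\<forall>i. degree (E $ i) \<le> 2"
  shows "(\<chi> i. eval2 (E $ i) x) = conic_pt E x"
proof -
  have "poly (E $ i) t = t\<^sup>2 * coeff (E $ i) 2 + t * coeff (E $ i) 1 + coeff (E $ i) 0" for i t
    by (subst degree_le_2_expand) (use assms in \<open>auto simp: algebra_simps power2_eq_square\<close>)
  then show ?thesis
    by (cases x) (simp_all add: conic_pt_def coeff_vec_def vec_eq_iff)
qed

text \<open>Expanding the determinant along its last row pairs \<open>G\<close> with the cross
  product of \<open>E\<close> and its derivative; the cubic terms of that product cancel.\<close>

lemma bieval_conic_biquadratic: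
  assumes "\<forall>i. degree (E $ i) \<le> 2" "\<forall>i. degree (G $ i) \<le> 2"
  shows "bieval (conic_biquadratic E G) x y =
    tangent_form (coeff_vec E 2) (coeff_vec E 1) (coeff_vec E 0) x \<bullet> conic_pt G y"
proof -
  define a b c where "a = coeff_vec E 2" "b = coeff_vec E 1" "c = coeff_vec E 0"
  define a' b' c' where "a' = coeff_vec G 2" "b' = coeff_vec G 1" "c' = coeff_vec G 0"
  have E: "E $ i = [:c $ i, b $ i, a $ i:]" and G: "G $ i = [:c' $ i, b' $ i, a' $ i:]" for i
    using degree_le_2_expand[of "E $ i"] degree_le_2_expand[of "G $ i"] assms
    by (simp_all add: a_b_c_def a'_b'_c'_def coeff_vec_def)
  define N where "N = tangent_form a b c"
  define m where "m i j = E $ i * pderiv (E $ j) - E $ j * pderiv (E $ i)" for i j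
  \<comment> \<open>\<open>N (Fin 0)\<close> and \<open>N Infty\<close> are the constant and the
    leading coefficient vector of the tangent form.\<close>
  have m: "m 2 3 = [:N (Fin 0) $ 1, (2 *\<^sub>R cross3 c a) $ 1, N Infty $ 1:]"
    "m 3 1 = [:N (Fin 0) $ 2, (2 *\<^sub>R cross3 c a) $ 2, N Infty $ 2:]"
    "m 1 2 = [:N (Fin 0) $ 3, (2 *\<^sub>R cross3 c a) $ 3, N Infty $ 3:]"
    unfolding m_def E N_def tangent_form_def
    by (simp_all add: pderiv_pCons cross3_def vector_3 algebra_simps)
  have "conic_biquadratic E G =
     [:m 2 3:] * [:[:c' $ 1:], [:b' $ 1:], [:a' $ 1:]:] +
     [:m 3 1:] * [:[:c' $ 2:], [:b' $ 2:], [:a' $ 2:]:] +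
     [:m 1 2:] * [:[:c' $ 3:], [:b' $ 3:], [:a' $ 3:]:]"
  proof -
    have "conic_biquadratic E G =
      ([:E $ 2:] * [:pderiv (E $ 3):] - [:E $ 3:] * [:pderiv (E $ 2):]) * map_poly (\<lambda>c. [:c:]) (G $ 1) +
      ([:E $ 3:] * [:pderiv (E $ 1):] - [:E $ 1:] * [:pderiv (E $ 3):]) * map_poly (\<lambda>c. [:c:]) (G $ 2) +
      ([:E $ 1:] * [:pderiv (E $ 2):] - [:E $ 2:] * [:pderiv (E $ 1):]) * map_poly (\<lambda>c. [:c:]) (G $ 3)"
      unfolding conic_biquadratic_def det_3 vector_3 by (simp only: vec_lambda_beta) algebra
    then show ?thesis by (simp add: G m_def map_poly_pCons mult.commute)
  qed
  then have "bieval (conic_biquadratic E G) x y = N x \<bullet> qform a' b' c' y"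
    unfolding m N_def tangent_form_def
    by (cases x; cases y; simp add: bieval_def numeral_2_eq_2 inner_vec_def sum_3)
       (simp_all add: algebra_simps power2_eq_square)
  then show ?thesis
    by (simp add: N_def conic_pt_def a_b_c_def a'_b'_c'_def)
qed

text \<open>At a finite point \<open>cross3 a b\<close> annihilates the \<open>a\<close> and
  \<open>b\<close> terms, leaving the determinant; at \<open>Infty\<close>, \<open>a = 0\<close>
  would make it vanish.\<close>

lemma qform_nonzero:
  assumes "cross3 a b \<bullet> c \<noteq> 0"
  shows "qform a b c x \<noteq> 0"
proof (cases x)
  case (Fin t)
  have "cross3 a b \<bullet> qform a b c (Fin t) = cross3 a b \<bullet> c"
    by (simp add: inner_add_right dot_cross_self)
  then show ?thesis using assms Fin by auto
next
  case Infty
  then show ?thesis using assms by auto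
qed

text \<open>A vector orthogonal to the basis \<open>a\<close>, \<open>b\<close>, \<open>c\<close> is
  zero, so here the scalar equation is nontrivial.\<close>

lemma at_most_two_qform_orthogonal:
  assumes "cross3 a b \<bullet> c \<noteq> 0" "v \<noteq> 0"
  shows "at_most_two {x. v \<bullet> qform a b c x = 0}"
proof -
  have "v \<bullet> a \<noteq> 0 \<or> v \<bullet> b \<noteq> 0 \<or> v \<bullet> c \<noteq> 0"
  proof (rule ccontr)
    assume "\<not> ?thesis"
    then have "v \<bullet> ((cross3 a b \<bullet> c) *\<^sub>R v) = 0"
      unfolding cramer_cross3[of a b c v] by (simp add: inner_add_right)
    then show False using assms by simp
  qed
  then show ?thesis unfolding inner_qform by (rule at_most_two_qform_roots)
qed

text \<open>Shows that independence of \<open>a\<close>, \<open>b\<close>, \<open>c\<close> passes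
  to the coefficients of the tangent form, which parameterizes the dual conic.\<close>

lemma tangent_form_triple:
  "cross3 (cross3 b a) (2 *\<^sub>R cross3 c a) \<bullet> cross3 c b = - 2 * (cross3 a b \<bullet> c)\<^sup>2"
  by (simp add: cross3_def inner_vec_def sum_3 vector_3 power2_eq_square algebra_simps)

lemma cross3_nonzero_span:
  assumes "span {u} \<noteq> span {v}" "u \<noteq> 0" "v \<noteq> 0"
  shows "cross3 u v \<noteq> 0"
proof
  assume "cross3 u v = 0"
  then obtain t where t: "v = t *\<^sub>R u" using assms by (auto simp: cross_eq_0 collinear_lemma)
  then have "t \<noteq> 0" using assms(3) by auto
  then have u: "u = (1 / t) *\<^sub>R v" using t by simp
  have "v \<in> span {u}" by (subst t) (intro span_scale span_base, simp)
  moreover have "u \<in> span {v}" by (subst u) (intro span_scale span_base, simp)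
  ultimately have "span {u} = span {v}"
    unfolding span_eq by simp
  then show False using assms(1) by simp
qed

lemma span_subset_tangent_line:
  "span {w} \<subseteq> tangent_line M (span {v}) \<longleftrightarrow> (M *v v) \<bullet> w = 0"
proof
  assume "span {w} \<subseteq> tangent_line M (span {v})"
  then show "(M *v v) \<bullet> w = 0"
    using span_base[of w "{w}"] span_base[of v "{v}"] by (auto simp: tangent_line_def)
next
  assume "(M *v v) \<bullet> w = 0"
  then show "span {w} \<subseteq> tangent_line M (span {v})"
    by (auto simp: tangent_line_def span_singleton matrix_vector_mult_scaleR)
qed

lemma rational_parameterization_conic_pt:
  assumes "rational_parameterization E M"
  shows "bij_betw (\<lambda>x. span {conic_pt E x}) UNIV (conic_points M)"
    and "conic_pt E x \<noteq> 0" and "conic_pt E x \<bullet> (M *v conic_pt E x) = 0"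
proof -
  show bij: "bij_betw (\<lambda>x. span {conic_pt E x}) UNIV (conic_points M)"
    using assms by (simp add: rational_parameterization_def eval2_conic_pt cong: conj_cong)
  then have "span {conic_pt E x} \<in> conic_points M" by (auto simp: bij_betw_def)
  then show "conic_pt E x \<noteq> 0" "conic_pt E x \<bullet> (M *v conic_pt E x) = 0"
    using span_base[of "conic_pt E x" "{conic_pt E x}"]
    by (auto simp: conic_points_def proj_point_def)
qed

section \<open>Tangents of a parameterized conic\<close>

text \<open>In terms of \<open>a\<close>, \<open>b\<close>, \<open>c\<close> the Gram matrix of
  \<open>M\<close> has only the nonzero entries \<open>B a c = B c a = K\<close> and
  \<open>B b b = - 2 * K\<close>; Cramer's rule then determines the polar.\<close>

lemma conic_parameterization_tangent:
  assumes irr: "irreducible_conic M" and par: "rational_parameterization E M"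
  defines "a \<equiv> coeff_vec E 2" and "b \<equiv> coeff_vec E 1" and "c \<equiv> coeff_vec E 0"
  shows "cross3 a b \<bullet> c \<noteq> 0"
    and "(M *v conic_pt E x) \<bullet> w = 0 \<longleftrightarrow> tangent_form a b c x \<bullet> w = 0"
proof -
  have sym: "transpose M = M" using irr by (simp add: irreducible_conic_def)
  have E: "conic_pt E = qform a b c" by (simp add: conic_pt_def a_def b_def c_def)
  define B where "B u v = (M *v u) \<bullet> v" for u v
  define D where "D = cross3 a b \<bullet> c"
  define K where "K = B a c"
  have lin: "B (u + v) w = B u w + B v w" "B u (v + w) = B u v + B u w"
    "B (r *\<^sub>R u) w = r * B u w" "B u (r *\<^sub>R w) = r * B u w" for u v w r
    by (simp_all add: B_def matrix_vector_right_distrib matrix_vector_mult_scaleR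
        inner_add_left inner_add_right)
  have comm: "B b a = B a b" "B c a = B a c" "B c b = B b c"
    unfolding B_def using inner_matrix_symmetric[OF sym] by (metis inner_commute)+
  have on: "B (qform a b c x) (qform a b c x) = 0" for x
    using rational_parameterization_conic_pt(3)[OF par, of x]
    by (simp add: B_def E inner_commute)
  have aa: "B a a = 0" using on[of Infty] by simp
  have cc: "B c c = 0" using on[of "Fin 0"] by simp
  have quartic: "2 * t ^ 3 * B a b + t\<^sup>2 * (2 * B a c + B b b) + 2 * t * B b c = 0" for t
    using on[of "Fin t"] by (simp add: lin comm aa cc algebra_simps power2_eq_square power3_eq_cube)
  \<comment> \<open>A cubic without constant term that vanishes at three nonzero points is
    zero.\<close>
  have ab: "B a b = 0" and bc: "B b c = 0" and bb: "B b b = - 2 * K"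
    using quartic[of 1] quartic[of "-1"] quartic[of 2] by (simp_all add: K_def)
  have "span {conic_pt E Infty} \<noteq> span {conic_pt E (Fin 0)}"
    using rational_parameterization_conic_pt(1)[OF par] by (auto simp: bij_betw_def dest: injD)
  then have ac: "cross3 a c \<noteq> 0"
    using rational_parameterization_conic_pt(2)[OF par, of Infty]
      rational_parameterization_conic_pt(2)[OF par, of "Fin 0"]
    by (intro cross3_nonzero_span) (auto simp: E)
  have K: "K \<noteq> 0"
  proof
    assume "K = 0"
    then have "cross3 a c = 0"
      using irreducible_conic_isotropic_line[OF irr, of a c] aa cc comm
      by (simp add: K_def B_def inner_commute)
    then show False using ac by simp
  qed
  have cramer: "D * B u w = (cross3 w b \<bullet> c) * B u a + (cross3 a w \<bullet> c) * B u b
      + (cross3 a b \<bullet> w) * B u c" for u w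
    using cramer_cross3[of a b c w] by (simp add: D_def lin flip: lin(4))
  have D: "D \<noteq> 0"
  proof
    assume "D = 0"
    \<comment> \<open>Pairing with \<open>b\<close> leaves only the \<open>B b b\<close> term of
      Cramer's rule; for \<open>w = cross3 a c\<close> its coefficient is minus a squared
      norm.\<close>
    then have "cross3 a (cross3 a c) \<bullet> c = 0"
      using cramer[of b "cross3 a c"] K by (simp add: comm ab bb bc)
    moreover have "cross3 a (cross3 a c) \<bullet> c = - (cross3 a c \<bullet> cross3 a c)"
      by (simp add: cross3_def inner_vec_def sum_3 vector_3 algebra_simps)
    ultimately show False using ac by simp
  qed
  then show "cross3 a b \<bullet> c \<noteq> 0" by (simp add: D_def)
  have skew: "cross3 b a \<bullet> w = - (cross3 a b \<bullet> w)" "cross3 c a \<bullet> w = cross3 a w \<bullet> c"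
    "cross3 c b \<bullet> w = - (cross3 w b \<bullet> c)"
    by (simp_all add: cross3_def inner_vec_def sum_3 vector_3 algebra_simps)
  have "D * B (qform a b c x) w = - K * (tangent_form a b c x \<bullet> w)"
    unfolding cramer tangent_form_def
    by (cases x) (simp_all add: lin comm aa ab bb bc cc K_def[symmetric] inner_add_left skew
        algebra_simps)
  then show "(M *v conic_pt E x) \<bullet> w = 0 \<longleftrightarrow> tangent_form a b c x \<bullet> w = 0"
    using D K by (simp add: B_def E) (metis mult_eq_0_iff neg_equal_0_iff_equal)
qed

theorem proposition25:
  fixes A B :: "real^3^3" and E G :: "real poly^3" and F :: "real poly poly"
  assumes "irreducible_conic A" and "irreducible_conic B"
    and "conic_points A \<noteq> conic_points B"
    and "generic_setting A B"
    and "rational_parameterization E A" and "rational_parameterization G B"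
    and "F = conic_biquadratic E G"
  shows "(periodic_on (poncelet_set A B) (poncelet_map A B) \<longleftrightarrow>
            periodic_on (john_curve F) (john_map F)) \<and>
         (periodic_on (poncelet_set A B) (poncelet_map A B) \<longrightarrow>
            (\<forall>n. has_period_on (poncelet_set A B) (poncelet_map A B) n \<longleftrightarrow>
                 has_period_on (john_curve F) (john_map F) n))"
proof -
  let ?Q = "\<lambda>x. span {conic_pt E x}" and ?P = "\<lambda>y. span {conic_pt G y}"
  let ?N = "tangent_form (coeff_vec E 2) (coeff_vec E 1) (coeff_vec E 0)"
  define \<phi> where "\<phi> = (\<lambda>(x, y). (?Q x, ?P y))"
  note A = conic_parameterization_tangent[OF assms(1,5)]
    and B = conic_parameterization_tangent[OF assms(2,6)]
  note Q = rational_parameterization_conic_pt(1)[OF assms(5)]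
    and P = rational_parameterization_conic_pt(1)[OF assms(6)]
  have Q_inj: "inj ?Q" and Q_img: "conic_points A = range ?Q"
    and P_inj: "inj ?P" and P_img: "conic_points B = range ?P"
    using Q P by (auto simp: bij_betw_def)
  have F: "bieval F x y = ?N x \<bullet> conic_pt G y" for x y
    using assms(5-7) by (simp add: bieval_conic_biquadratic rational_parameterization_def)
  have inc: "?P y \<subseteq> tangent_line A (?Q x) \<longleftrightarrow> bieval F x y = 0" for x y
    by (simp add: span_subset_tangent_line A(2) F)
  have triple: "cross3 (cross3 b a) (2 *\<^sub>R cross3 c a) \<bullet> cross3 c b \<noteq> 0"
    if "cross3 a b \<bullet> c \<noteq> 0" for a b c
    using that by (simp add: tangent_form_triple)
  \<comment> \<open>In \<open>y\<close> the coefficient vectors are those of \<open>G\<close>,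
    paired with the nonzero vector \<open>?N x\<close>; in \<open>x\<close> they are those of the
    tangent form, paired with the nonzero \<open>conic_pt G y\<close>.\<close>
  have two_y: "at_most_two {y. bieval F x y = 0}" for x
    unfolding F conic_pt_def
    by (intro at_most_two_qform_orthogonal B(1))
      (unfold tangent_form_def, intro qform_nonzero triple A(1))
  have two_x: "at_most_two {x. bieval F x y = 0}" for y
    unfolding F inner_commute[of _ "conic_pt G y"] tangent_form_def
    by (intro at_most_two_qform_orthogonal triple A(1)
        rational_parameterization_conic_pt(2)[OF assms(6)])
  have IB: "poncelet_IB A B (\<phi> z) = \<phi> (john_I1 F z)" if z_in: "z \<in> john_curve F" for z
  proof -
    obtain x y where z: "z = (x, y)" "bieval F x y = 0"
      using z_in by (auto simp: john_curve_def)
    have "{R \<in> conic_points B. R \<subseteq> tangent_line A (?Q x)} = ?P ` {y. bieval F x y = 0}"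
      by (unfold P_img inc[symmetric]) blast
    then show ?thesis
      using other_image[OF two_y] z
      by (simp add: poncelet_IB_def john_I1_def \<phi>_def)
  qed
  have IA: "poncelet_IA A (\<phi> z) = \<phi> (john_I2 F z)" if z_in: "z \<in> john_curve F" for z
  proof -
    obtain x y where z: "z = (x, y)" "bieval F x y = 0"
      using z_in by (auto simp: john_curve_def)
    have "{R \<in> conic_points A. ?P y \<subseteq> tangent_line A R} = ?Q ` {x. bieval F x y = 0}"
      by (unfold Q_img inc[symmetric]) blast
    then show ?thesis
      using other_image[OF two_x] z
      by (simp add: poncelet_IA_def john_I2_def \<phi>_def)
  qed
  have I1: "john_I1 F z \<in> john_curve F" "john_I1 F (john_I1 F z) = z"
    and I2: "john_I2 F z \<in> john_curve F" if "z \<in> john_curve F" for z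
    using that other_in[OF two_y] other_other[OF two_y] other_in[OF two_x]
    by (auto simp: john_curve_def john_I1_def john_I2_def)
  have "bij_betw \<phi> (john_curve F) (poncelet_set A B)"
  proof (rule bij_betw_imageI)
    show "inj_on \<phi> (john_curve F)"
      using Q_inj P_inj by (auto simp: inj_on_def \<phi>_def)
    show "\<phi> ` john_curve F = poncelet_set A B"
      by (auto simp: \<phi>_def john_curve_def poncelet_set_def P_img Q_img simp flip: inc)
  qed
  moreover have "bij_betw (john_I1 F) (john_curve F) (john_curve F)"
    using I1 by (intro bij_betw_byWitness[where f' = "john_I1 F"]) auto
  ultimately have bij: "bij_betw (\<phi> \<circ> john_I1 F) (john_curve F) (poncelet_set A B)"
    by (rule bij_betw_trans[rotated])
  \<comment> \<open>Both sides equal \<open>\<phi>\<close> applied to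
    \<open>I\<^sub>1 I\<^sub>2 I\<^sub>1 z\<close>.\<close>
  have conj: "poncelet_map A B ((\<phi> \<circ> john_I1 F) z) = (\<phi> \<circ> john_I1 F) (john_map F z)"
    if "z \<in> john_curve F" for z
    using that by (simp add: poncelet_map_def john_map_def IA IB I1 I2)
  have "john_map F ` john_curve F \<subseteq> john_curve F"
    by (auto simp: john_map_def intro!: I1 I2)
  from periods_conjugate[OF bij this conj] show ?thesis by blast
qed

end
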